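(* Let $p$ be an odd prime, let $s,h,t,r$ be positive integers with $r$ odd, $t\mid h$, $s<h$, and let $q=p^h$ satisfy $q\equiv1\pmod8$ or $q\equiv3\pmod8$. Put $n=rp^s$. Assume that $\mathbb{F}_q$ is the splitting field of $g(x)=x^{n}+\sum_{i=1}^{\frac{n-1}{2}}a_ix^{n-i}+c\in\mathbb{F}_{p^t}[x]$ with $c\neq0$ and $a_i\ne0$ for $1\le i\le\frac{n-1}{2}$, and that $\alpha_1,\dots,\alpha_n$ are all the roots of $g(x)$ and are pairwise distinct. Let $v_i\in\mathbb{F}_{q^2}$ be such that $v_i^2=(g'(\alpha_i))^{-1}$ for $1\le i\le n$ (such $v_i$ exist). Let $\boldsymbol{\alpha}=(\alpha_1,\dots,\alpha_n)$ and $\boldsymbol{v}=(v_1,\dots,v_n)$. Let $\eta\in\mathbb{F}_q^*$ with $\eta^{\frac{q-1}{2}}=1$, and $$\mathcal{S}_2=\Big\{\sum_{i=0}^{\frac{n-3}{2}}f_ix^i+f_0(-2\eta)^{\frac12}x^{\frac{n-1}{2}}+f_0\,\eta\Big(\sum_{j=1}^{\frac{n-1}{2}}a_jx^{n-1-j}+x^{n-1}\Big): f_i\in\mathbb{F}_{q^2}\text{ for }0\le i\le\tfrac{n-3}{2}\Big\},$$ and let $\mathcal{C}_2=ev_{\boldsymbol{\alpha},\boldsymbol{v}}(\mathcal{S}_2)\subseteq\mathbb{F}_{q^2}^n$. Then there exists a $[[rp^s,\,1,\,\mathrm{wt}(\mathcal{C}_2^\perp\setminus\mathcal{C}_2)]]_{q^2}$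 quantum stabilizer code.
   Context: $(-2\eta)^{1/2}$ denotes a fixed square root of $-2\eta$ in $\mathbb{F}_q$ (it exists under the stated hypotheses). $ev_{\boldsymbol{\alpha},\boldsymbol{v}}(f)=(v_1f(\alpha_1),\dots,v_nf(\alpha_n))$. $\mathcal{C}^\perp$ is the Euclidean dual. For a set $X$ of vectors, $\mathrm{wt}(X)$ is the minimum Hamming weight of a nonzero element of $X$. Quantum codes: let $Q$ be a power of a prime $p$ (here $Q=q^2$), $\zeta=e^{2\pi i/p}$, $\mathrm{Tr}:\mathbb{F}_Q\to\mathbb{F}_p$ the trace; on $\mathbb{C}^Q$ with orthonormal basis $\{|x\rangle:x\in\mathbb{F}_Q\}$ let $X(a)|x\rangle=|x+a\rangle$, $Z(b)|x\rangle=\zeta^{\mathrm{Tr}(bx)}|x\rangle$, and for $\boldsymbol{a},\boldsymbol{b}\in\mathbb{F}_Q^n$ let $X(\boldsymbol{a})=\bigotimes X(a_i)$, $Z(\boldsymbol{b})=\bigotimes Z(b_i)$ on $(\mathbb{C}^Q)^{\otimes n}$. The error group consists of all $\zeta^cX(\boldsymbol{a})Z(\boldsymbol{b})$; the weight of such an element is the number of $i$ with $(a_i,b_i)\neq(0,0)$. A stabilizer code is a nonzero joint $+1$-eigenspace of an abelian subgroup of the error group. It is an $[[n,K,d]]_Q$ code if it has dimension $Q^K$ and minimum distance $d$, i.e. $d$ is the largest integer such that every error $E$ of weight less than $d$ is detectable ($PEP=c_EP$ for a scalar $c_E$, $P$ the orthogonal projector onto the code). *)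

theory Defs
  imports
    "HOL-Analysis.Analysis"
    "HOL-Computational_Algebra.Computational_Algebra"
    "HOL-Algebra.Group"
begin

section \<open>Subfields and splitting fields inside a fixed ambient field\<close>

definition is_subfield :: "'a::field set \<Rightarrow> bool" where
  "is_subfield K \<longleftrightarrow> 0 \<in> K \<and> 1 \<in> K \<and>
     (\<forall>x\<in>K. \<forall>y\<in>K. x + y \<in> K \<and> x * y \<in> K) \<and> (\<forall>x\<in>K. - x \<in> K \<and> inverse x \<in> K)"

definition splits_over :: "'a::field poly \<Rightarrow> 'a set \<Rightarrow> bool" where
  "splits_over g L \<longleftrightarrow>
     (\<exists>c as. c \<in> L \<and> set as \<subseteq> L \<and> g = smult c (\<Prod>a\<leftarrow>as. [:- a, 1:]))"

definition is_splitting_field :: "'a::field poly \<Rightarrow> 'a set \<Rightarrow> 'a set \<Rightarrow> bool" where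
  "is_splitting_field g K L \<longleftrightarrow>
     is_subfield K \<and> is_subfield L \<and> K \<subseteq> L \<and> (\<forall>i. coeff g i \<in> K) \<and> splits_over g L \<and>
     (\<forall>M. is_subfield M \<and> K \<subseteq> M \<and> M \<subseteq> L \<and> splits_over g M \<longrightarrow> M = L)"


section \<open>Classical codes\<close>

definition ev :: "'a::field ^ 'n \<Rightarrow> 'a ^ 'n \<Rightarrow> 'a poly \<Rightarrow> 'a ^ 'n" where
  "ev \<alpha> v f = (\<chi> i. v $ i * poly f (\<alpha> $ i))"

definition euclidean_dual :: "('a::field ^ 'n) set \<Rightarrow> ('a ^ 'n) set" where
  "euclidean_dual C = {x. \<forall>y\<in>C. (\<Sum>i\<in>UNIV. x $ i * y $ i) = 0}"

definition hamming_wt :: "'a::zero ^ 'n \<Rightarrow> nat" where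
  "hamming_wt x = card {i. x $ i \<noteq> 0}"

text \<open>Only meaningful if \<open>X\<close> is finite and contains a nonzero vector.\<close>
definition min_wt :: "('a::zero ^ 'n) set \<Rightarrow> nat" where
  "min_wt X = Min (hamming_wt ` (X - {0}))"


section \<open>Stabilizer codes over a finite field\<close>

text \<open>With \<open>'a\<close> the field of \<open>Q\<close> elements, \<open>\<complex>\<^sup>Q\<close> is \<open>complex ^ 'a\<close>, the basis vector
  \<open>|x\<rangle>\<close> being \<open>axis x 1\<close>. The \<open>n\<close>-fold tensor power is \<open>complex ^ ('a ^ 'n)\<close> with
  \<open>n = CARD('n)\<close>, where \<open>|x\<^sub>1\<rangle> \<otimes> \<dots> \<otimes> |x\<^sub>n\<rangle>\<close> is the basis vector indexed by the
  tuple \<open>(x\<^sub>1, \<dots>, x\<^sub>n) :: 'a ^ 'n\<close>. Operators are square matrices in these bases.\<close>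

type_synonym ('a, 'n) state = "complex ^ ('a ^ 'n)"
type_synonym ('a, 'n) operator = "complex ^ ('a ^ 'n) ^ ('a ^ 'n)"

text \<open>The trace to the prime field, as the sum of the conjugates; its value is an element of the
  prime field, still regarded as an element of \<open>'a\<close>.\<close>
definition abs_trace :: "'a::finite_field \<Rightarrow> 'a" where
  "abs_trace x = (\<Sum>i < (THE m. CARD('a) = CHAR('a) ^ m). x ^ (CHAR('a) ^ i))"

definition zeta :: "'a::finite_field itself \<Rightarrow> complex" where
  "zeta _ = exp (2 * of_real pi * \<i> / of_nat CHAR('a))"

text \<open>\<open>\<zeta>\<close> to the power \<open>Tr y\<close>, for the integer representative of \<open>Tr y\<close> in \<open>{0..<p}\<close>.\<close>
definition zeta_trace :: "'a::finite_field \<Rightarrow> complex" where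
  "zeta_trace y = zeta TYPE('a) ^ (THE k. k < CHAR('a) \<and> of_nat k = abs_trace y)"

definition X_op :: "'a::finite_field \<Rightarrow> complex ^ ('a::finite_field) ^ ('a::finite_field)" where
  "X_op a = (\<chi> y x. if y = x + a then 1 else 0)"

definition Z_op :: "'a::finite_field \<Rightarrow> complex ^ ('a::finite_field) ^ ('a::finite_field)" where
  "Z_op b = (\<chi> y x. if y = x then zeta_trace (b * x) else 0)"

lemma mult_ket: "A *v axis x 1 = column x A" for A :: "complex ^ 'm::finite ^ 'k::finite"
proof -
  have "(\<Sum>j\<in>UNIV. A $ i $ j * (if j = x then 1 else 0)) = A $ i $ x" for i
    by (simp add: if_distrib cong: if_cong)
  then show ?thesis
    by (simp add: matrix_vector_mult_def axis_def column_def)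
qed

lemma X_op_ket: "X_op a *v axis x 1 = axis (x + a) 1"
  unfolding mult_ket by (auto simp: column_def X_op_def axis_def vec_eq_iff)

lemma Z_op_ket: "Z_op b *v axis x 1 = zeta_trace (b * x) *s axis x 1"
  unfolding mult_ket by (auto simp: column_def Z_op_def axis_def vec_eq_iff)

definition tensor :: "('n \<Rightarrow> complex ^ 'a ^ 'a) \<Rightarrow> ('a::finite, 'n::finite) operator" where
  "tensor A = (\<chi> y x. \<Prod>i\<in>UNIV. A i $ (y $ i) $ (x $ i))"

definition X_tensor :: "'a::finite_field ^ 'n::finite \<Rightarrow> ('a, 'n) operator" where
  "X_tensor a = tensor (\<lambda>i. X_op (a $ i))"

definition Z_tensor :: "'a::finite_field ^ 'n::finite \<Rightarrow> ('a, 'n) operator" where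
  "Z_tensor b = tensor (\<lambda>i. Z_op (b $ i))"

lemma X_tensor_ket: "X_tensor a *v axis x 1 = axis (x + a) 1"
proof -
  have "(\<Prod>i\<in>UNIV. if y $ i = x $ i + a $ i then 1 else 0) = (if y = x + a then 1 else (0::complex))"
    for y
    by (cases "y = x + a") (auto simp: vec_eq_iff)
  then show ?thesis
    unfolding mult_ket
    by (auto simp: column_def X_tensor_def X_op_def tensor_def axis_def vec_eq_iff)
qed

lemma Z_tensor_ket:
  "Z_tensor b *v axis x 1 = (\<Prod>i\<in>UNIV. zeta_trace (b $ i * x $ i)) *s axis x 1"
proof -
  have "(\<Prod>i\<in>UNIV. if y $ i = x $ i then zeta_trace (b $ i * x $ i) else 0) =
      (if y = x then \<Prod>i\<in>UNIV. zeta_trace (b $ i * x $ i) else 0)"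
    for y
    by (cases "y = x") (auto simp: vec_eq_iff)
  then show ?thesis
    unfolding mult_ket
    by (simp add: column_def Z_tensor_def Z_op_def tensor_def axis_def vec_eq_iff[of "vec_lambda _"])
qed

definition pauli :: "nat \<Rightarrow> 'a::finite_field ^ 'n::finite \<Rightarrow> 'a ^ 'n \<Rightarrow> ('a, 'n) operator" where
  "pauli c a b = mat (zeta TYPE('a) ^ c) ** (X_tensor a ** Z_tensor b)"

definition error_group :: "('a::finite_field, 'n::finite) operator monoid" where
  "error_group = \<lparr>carrier = {pauli c a b | c a b. True}, mult = (**), one = mat 1\<rparr>"

definition pauli_wt :: "'a::finite_field ^ 'n::finite \<Rightarrow> 'a ^ 'n \<Rightarrow> nat" where
  "pauli_wt a b = card {i. (a $ i, b $ i) \<noteq> (0, 0)}"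

definition joint_fixed_space :: "('a::finite_field, 'n::finite) operator set \<Rightarrow> ('a, 'n) state set" where
  "joint_fixed_space S = {\<psi>. \<forall>E\<in>S. E *v \<psi> = \<psi>}"

definition stabilizer_code :: "('a::finite_field, 'n::finite) state set \<Rightarrow> bool" where
  "stabilizer_code V \<longleftrightarrow>
     (\<exists>S. subgroup S error_group \<and> (\<forall>A\<in>S. \<forall>B\<in>S. A ** B = B ** A) \<and>
          V = joint_fixed_space S \<and> V \<noteq> {0})"

definition orthogonal_projector :: "complex ^ 'm ^ 'm \<Rightarrow> (complex ^ 'm::finite) set \<Rightarrow> bool" where
  "orthogonal_projector P V \<longleftrightarrow>
     P ** P = P \<and> (\<forall>i j. P $ i $ j = cnj (P $ j $ i)) \<and> range (\<lambda>\<psi>. P *v \<psi>) = V"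

text \<open>The orthogonal projector onto a subspace exists and is unique, so the quantifier over \<open>P\<close>
  only names it. The matrix \<open>mat c ** P\<close> is \<open>c P\<close>.\<close>
definition detectable :: "(complex ^ 'm::finite) set \<Rightarrow> complex ^ 'm ^ 'm \<Rightarrow> bool" where
  "detectable V E \<longleftrightarrow> (\<exists>P. orthogonal_projector P V \<and> (\<exists>c. P ** E ** P = mat c ** P))"

definition detects_below :: "('a::finite_field, 'n::finite) state set \<Rightarrow> nat \<Rightarrow> bool" where
  "detects_below V d \<longleftrightarrow> (\<forall>c a b. pauli_wt a b < d \<longrightarrow> detectable V (pauli c a b))"

definition has_min_distance :: "('a::finite_field, 'n::finite) state set \<Rightarrow> nat \<Rightarrow> bool" where
  "has_min_distance V d \<longleftrightarrow> detects_below V d \<and> (\<forall>d'. detects_below V d' \<longrightarrow> d' \<le> d)"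

text \<open>\<open>V\<close> is an \<open>[[n, K, d]]\<^sub>Q\<close> stabilizer code.\<close>
definition stabilizer_code_params ::
    "('a::finite_field, 'n::finite) state set \<Rightarrow> nat \<Rightarrow> nat \<Rightarrow> nat \<Rightarrow> nat \<Rightarrow> bool" where
  "stabilizer_code_params V n K d Q \<longleftrightarrow>
     CARD('n) = n \<and> CARD('a) = Q \<and> stabilizer_code V \<and> vec.dim V = Q ^ K \<and> has_min_distance V d"

end

theory Submission
  imports Defs "HOL-Number_Theory.Cong"
begin

text \<open>
  If a linear code \<open>C\<close> over the field of \<open>Q\<close> elements satisfies \<open>C \<subseteq> C\<^sup>\<bottom>\<close>, then the operators
  \<open>X(a) Z(b)\<close> with \<open>a, b \<in> C\<close> form an abelian group without any correcting phases, and the vectors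
  they fix are the functions supported on \<open>C\<^sup>\<bottom>\<close> and constant on the cosets of \<open>C\<close>. This space has
  dimension \<open>|C\<^sup>\<bottom>| / |C|\<close>. An error \<open>X(a) Z(b)\<close> acts on it as a scalar if \<open>a, b \<in> C\<close>, moves it to an
  orthogonal space if \<open>a \<notin> C\<^sup>\<bottom>\<close> or \<open>b \<notin> C\<^sup>\<bottom>\<close>, and is undetectable otherwise, so the distance is the
  minimum weight of \<open>C\<^sup>\<bottom> - C\<close>.

  For \<open>C\<^sub>2\<close> the inner product of the images of \<open>f\<close> and \<open>f'\<close> is \<open>L (f f')\<close> with
  \<open>L f = \<Sum>\<^sub>i f(\<alpha>\<^sub>i) / g'(\<alpha>\<^sub>i)\<close>. By Lagrange interpolation \<open>L f\<close> is the coefficient of \<open>x\<^bsup>n-1\<^esup>\<close> in \<open>f\<close>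
  when \<open>deg f < n\<close>. The twist of \<open>S\<^sub>2\<close> is \<open>B = \<rho> x\<^bsup>(n-1)/2\<^esup> + \<eta> w\<close> with \<open>x w = g - c\<close>, so \<open>w\<close> acts as
  \<open>-c/x\<close> at the roots of \<open>g\<close>; this gives \<open>L (f f') = f\<^sub>0 f'\<^sub>0 (\<rho>\<^sup>2 + 2 \<eta>) = 0\<close>. The map
  \<open>f \<mapsto> ev f\<close> is injective on \<open>S\<^sub>2\<close>, hence \<open>|C\<^sub>2| = Q\<^bsup>(n-1)/2\<^esup>\<close> and the fixed space has dimension \<open>Q\<close>.
\<close>

section \<open>The trace character\<close>

lemma zeta_power_eq_1_iff:
  "zeta TYPE('a::finite_field) ^ k = 1 \<longleftrightarrow> CHAR('a) dvd k"
proof -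
  have "zeta TYPE('a) ^ k = exp (2 * of_real pi * \<i> * of_nat k / of_nat CHAR('a))"
    by (simp add: zeta_def mult_ac flip: exp_of_nat_mult)
  then show ?thesis
    using complex_root_unity_eq_1[of "CHAR('a)" k] prime_ge_1_nat[of "CHAR('a)"] by simp
qed

text \<open>Since \<open>zeta\<close> is a root of unity of order \<open>CHAR('a)\<close>, any
  natural number that represents a trace may serve as exponent, reduced or not.\<close>

lemma zeta_power_cong:
  assumes "of_nat j = (of_nat k :: 'a::finite_field)"
  shows "zeta TYPE('a) ^ j = zeta TYPE('a) ^ k"
proof -
  have *: "zeta TYPE('a) ^ j = zeta TYPE('a) ^ (j mod CHAR('a))" for j
  proof -
    have "zeta TYPE('a) ^ j = zeta TYPE('a) ^ (CHAR('a) * (j div CHAR('a)) + j mod CHAR('a))"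
      by simp
    also have "\<dots> = zeta TYPE('a) ^ (CHAR('a) * (j div CHAR('a))) * zeta TYPE('a) ^ (j mod CHAR('a))"
      by (rule power_add)
    also have "zeta TYPE('a) ^ (CHAR('a) * (j div CHAR('a))) = 1"
      by (simp add: zeta_power_eq_1_iff)
    finally show ?thesis by simp
  qed
  from assms have "j mod CHAR('a) = k mod CHAR('a)"
    by (simp add: of_nat_eq_iff_cong_CHAR cong_def)
  then show ?thesis by (metis *)
qed

text \<open>The \<open>CHAR('a)\<close> distinct images of the natural numbers are roots of x^p - x,
  which has at most p roots. This supplies the witness that the definite description in
  \<open>zeta_trace\<close> asks for.\<close>

lemma fixed_by_Frobenius_eq_of_nat:
  fixes y :: "'a::finite_field"
  assumes "y ^ CHAR('a) = y"
  shows "\<exists>k<CHAR('a). of_nat k = y"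
proof -
  let ?p = "CHAR('a)"
  let ?f = "monom 1 ?p - monom 1 1 :: 'a poly"
  have p: "prime ?p" by simp
  have inj: "inj_on (of_nat :: nat \<Rightarrow> 'a) {..<?p}"
    by (auto intro!: inj_onI simp: of_nat_eq_iff_cong_CHAR cong_def)
  have Frob: "(of_nat k :: 'a) ^ ?p = of_nat k" for k
  proof (induction k)
    case (Suc k)
    then show ?case using freshmans_dream[OF p refl, of 1 "of_nat k"] by simp
  qed (use p in \<open>simp add: power_0_left\<close>)
  have "coeff ?f ?p = 1" using prime_gt_1_nat[OF p] by simp
  then have "?f \<noteq> 0" by (metis coeff_0 zero_neq_one)
  then have "card {x. poly ?f x = 0} \<le> degree ?f" and fin: "finite {x. poly ?f x = 0}"
    by (rule card_poly_roots_bound, rule poly_roots_finite)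
  moreover have "degree ?f \<le> ?p"
    using prime_ge_1_nat[OF p]
    by (intro degree_diff_le degree_monom_le order.trans[OF degree_monom_le])
  moreover have sub: "of_nat ` {..<?p} \<subseteq> {x. poly ?f x = 0}"
    by (auto simp: poly_monom Frob)
  ultimately have "of_nat ` {..<?p} = {x. poly ?f x = 0}"
    using card_seteq[OF fin sub] by (simp add: card_image[OF inj])
  moreover have "y \<in> {x. poly ?f x = 0}" using assms by (simp add: poly_monom)
  ultimately have "y \<in> of_nat ` {..<?p}" by simp
  then show ?thesis by auto
qed

lemma abs_trace_eq:
  fixes x :: "'a::finite_field"
  assumes "CARD('a) = CHAR('a) ^ m"
  shows "abs_trace x = (\<Sum>i<m. x ^ (CHAR('a) ^ i))"
proof -
  have "1 < CHAR('a)" using prime_gt_1_nat[of "CHAR('a)"] by simp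
  then have "(THE m. CARD('a) = CHAR('a) ^ m) = m"
    using assms by auto
  then show ?thesis unfolding abs_trace_def by simp
qed

lemma abs_trace_add:
  fixes x y :: "'a::finite_field"
  assumes "CARD('a) = CHAR('a) ^ m"
  shows "abs_trace (x + y) = abs_trace x + abs_trace y"
  by (simp add: abs_trace_eq[OF assms] freshmans_dream' sum.distrib)

text \<open>Frobenius permutes the conjugates cyclically, because x^(p^m) = x.\<close>

lemma abs_trace_power_CHAR:
  fixes x :: "'a::finite_field"
  assumes m: "CARD('a) = CHAR('a) ^ m"
  shows "abs_trace x ^ CHAR('a) = abs_trace x"
proof -
  have "abs_trace x ^ CHAR('a) = (\<Sum>i<m. x ^ (CHAR('a) ^ Suc i))"
    by (simp add: abs_trace_eq[OF m] freshmans_dream_sum mult.commute flip: power_mult)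
  \<comment> \<open>The missing term of the shifted sum is added so that both sums become the one
    over \<open>i < Suc m\<close>.\<close>
  also have "\<dots> + x = (\<Sum>i<Suc m. x ^ (CHAR('a) ^ i))"
    by (subst sum.lessThan_Suc_shift) simp
  also have "\<dots> = abs_trace x + x"
    using finite_field_power_card_eq_same[of x] by (simp add: abs_trace_eq[OF m] m)
  finally show ?thesis by simp
qed

text \<open>The trace is a nonzero polynomial function of degree at most p^(m-1), too small to
  vanish at all p^m elements.\<close>

lemma abs_trace_neq_0:
  assumes m: "CARD('a::finite_field) = CHAR('a) ^ m"
  shows "\<exists>x::'a. abs_trace x \<noteq> 0"
proof (rule ccontr)
  assume *: "\<not> ?thesis"
  let ?p = "CHAR('a)"
  let ?f = "\<Sum>i<m. monom 1 (?p ^ i) :: 'a poly"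
  have p: "1 < ?p" using prime_gt_1_nat[of ?p] by simp
  have "m \<noteq> 0"
  proof
    assume "m = 0"
    then have "card {0, 1 :: 'a} \<le> 1" using m card_mono[of UNIV "{0, 1 :: 'a}"] by simp
    then show False by simp
  qed
  then obtain l where l: "m = Suc l" by (cases m) auto
  have inj: "?p ^ i = ?p ^ j \<longleftrightarrow> i = j" for i j using p by simp
  have "coeff ?f (?p ^ l) = 1"
    by (simp add: l coeff_sum inj)
  then have "?f \<noteq> 0" by (metis coeff_0 zero_neq_one)
  then have "card {x. poly ?f x = 0} \<le> degree ?f"
    by (rule card_poly_roots_bound)
  also have "degree ?f \<le> ?p ^ l"
    using p by (intro degree_sum_le order.trans[OF degree_monom_le] power_increasing) (auto simp: l)
  also have "{x. poly ?f x = 0} = UNIV"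
    using * by (simp add: poly_sum poly_monom abs_trace_eq[OF m])
  finally show False using p by (simp add: m l)
qed

lemma zeta_trace_eq:
  fixes y :: "'a::finite_field"
  assumes m: "CARD('a) = CHAR('a) ^ m"
  shows "\<exists>k. of_nat k = abs_trace y \<and> zeta_trace y = zeta TYPE('a) ^ k"
proof -
  obtain k where k: "k < CHAR('a)" "of_nat k = abs_trace y"
    using fixed_by_Frobenius_eq_of_nat[OF abs_trace_power_CHAR[OF m]] by blast
  have "(THE k. k < CHAR('a) \<and> of_nat k = abs_trace y) = k"
  proof (rule the_equality)
    fix j assume "j < CHAR('a) \<and> of_nat j = abs_trace y"
    then have "of_nat j = (of_nat k :: 'a)" "j < CHAR('a)" using k by simp_all
    then show "j = k" using k(1) by (simp add: of_nat_eq_iff_cong_CHAR cong_def)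
  qed (use k in simp)
  then show ?thesis unfolding zeta_trace_def using k by blast
qed

lemma zeta_trace_add:
  fixes x y :: "'a::finite_field"
  assumes m: "CARD('a) = CHAR('a) ^ m"
  shows "zeta_trace (x + y) = zeta_trace x * zeta_trace y"
proof -
  obtain i j k where
    "of_nat i = abs_trace x" "zeta_trace x = zeta TYPE('a) ^ i"
    "of_nat j = abs_trace y" "zeta_trace y = zeta TYPE('a) ^ j"
    "of_nat k = abs_trace (x + y)" "zeta_trace (x + y) = zeta TYPE('a) ^ k"
    using zeta_trace_eq[OF m] by metis
  moreover from this have "zeta TYPE('a) ^ k = zeta TYPE('a) ^ (i + j)"
    by (intro zeta_power_cong) (simp add: abs_trace_add[OF m])
  ultimately show ?thesis by (simp add: power_add)
qed

lemma zeta_trace_neq_1: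
  assumes m: "CARD('a::finite_field) = CHAR('a) ^ m"
  shows "\<exists>x::'a. zeta_trace x \<noteq> 1"
proof -
  obtain x :: 'a where x: "abs_trace x \<noteq> 0" using abs_trace_neq_0[OF m] by blast
  obtain k where k: "of_nat k = abs_trace x" "zeta_trace x = zeta TYPE('a) ^ k"
    using zeta_trace_eq[OF m] by blast
  with x have "\<not> CHAR('a) dvd k" by (metis of_nat_eq_0_iff_char_dvd)
  then show ?thesis using k zeta_power_eq_1_iff by metis
qed

section \<open>Characters of the vector space and cardinality of the dual\<close>

definition chi :: "'a::finite_field ^ 'n::finite \<Rightarrow> 'a ^ 'n \<Rightarrow> complex" where
  "chi x y = zeta_trace (\<Sum>i\<in>UNIV. x $ i * y $ i)"

lemma chi_commute: "chi x y = chi y x"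
  by (simp add: chi_def mult.commute)

lemma euclidean_dual_subspace: "vec.subspace (euclidean_dual C)"
proof (rule vec.subspaceI)
  fix b and x assume "x \<in> euclidean_dual C"
  moreover have "(\<Sum>i\<in>UNIV. (b *s x) $ i * y $ i) = b * (\<Sum>i\<in>UNIV. x $ i * y $ i)" for y
    by (simp add: sum_distrib_left mult.assoc)
  ultimately show "b *s x \<in> euclidean_dual C" by (simp add: euclidean_dual_def)
next
  fix x y assume "x \<in> euclidean_dual C" "y \<in> euclidean_dual C"
  then show "x + y \<in> euclidean_dual C"
    by (simp add: euclidean_dual_def distrib_right sum.distrib)
qed (simp add: euclidean_dual_def)

lemma euclidean_dual_UNIV: "euclidean_dual (UNIV :: ('a::field ^ 'n::finite) set) = {0}"
proof -
  have "x = 0" if "x \<in> euclidean_dual UNIV" for x :: "'a ^ 'n"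
  proof -
    have "x $ i = 0" for i
    proof -
      have "(\<Sum>j\<in>UNIV. x $ j * axis i 1 $ j) = 0" using that by (simp add: euclidean_dual_def)
      then show ?thesis by (simp add: axis_def if_distrib cong: if_cong)
    qed
    then show ?thesis by (simp add: vec_eq_iff)
  qed
  then show ?thesis by (auto simp: euclidean_dual_def)
qed

text \<open>Every finite field satisfies the assumption; the exponent is needed to evaluate the definite
  description in \<^const>\<open>abs_trace\<close>.\<close>
locale trace_character =
  fixes m :: nat and ty :: "'a::finite_field itself"
  assumes card_eq: "CARD('a) = CHAR('a) ^ m"
begin

lemma zeta_trace_0: "zeta_trace (0 :: 'a) = 1"
proof -
  have "zeta_trace (0 :: 'a) \<noteq> 0"
    using zeta_trace_eq[OF card_eq, of 0] by (auto simp: zeta_def)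
  then show ?thesis using zeta_trace_add[OF card_eq, of 0 0] by simp
qed

lemma chi_add_left: "chi (x + y) z = chi x z * chi y (z :: 'a ^ 'n::finite)"
  by (simp add: chi_def algebra_simps sum.distrib zeta_trace_add[OF card_eq])

lemma chi_add_right: "chi z (x + y) = chi z x * chi z (y :: 'a ^ 'n::finite)"
  by (metis chi_add_left chi_commute)

lemma chi_0: "chi (0 :: 'a ^ 'n::finite) x = 1" "chi x (0 :: 'a ^ 'n) = 1"
  by (simp_all add: chi_def zeta_trace_0)

lemma chi_eq_1: "x \<in> euclidean_dual C \<Longrightarrow> y \<in> C \<Longrightarrow> chi x y = 1" for x :: "'a ^ 'n::finite"
  by (simp add: chi_def euclidean_dual_def zeta_trace_0)

text \<open>The trace can vanish on nonzero inner products. Closure of \<open>C\<close> under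
  scalars repairs this: rescaling \<open>y\<close> turns a nonzero inner product into any prescribed
  value \<open>t\<close>.\<close>

lemma mem_dual_if_chi_eq_1:
  fixes C :: "('a ^ 'n::finite) set"
  assumes "vec.subspace C" and "\<And>y. y \<in> C \<Longrightarrow> chi x y = 1"
  shows "x \<in> euclidean_dual C"
proof (rule ccontr)
  assume "x \<notin> euclidean_dual C"
  then obtain y where y: "y \<in> C" "(\<Sum>i\<in>UNIV. x $ i * y $ i) \<noteq> 0" (is "?e \<noteq> 0")
    by (auto simp: euclidean_dual_def)
  obtain t :: 'a where t: "zeta_trace t \<noteq> 1" using zeta_trace_neq_1[OF card_eq] by blast
  have "(\<Sum>i\<in>UNIV. x $ i * ((t / ?e) *s y) $ i) = t / ?e * ?e"
    unfolding sum_distrib_left by (intro sum.cong) auto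
  then have "chi x ((t / ?e) *s y) = zeta_trace t" using y by (simp add: chi_def)
  moreover have "(t / ?e) *s y \<in> C" using assms(1) y by (intro vec.subspace_scale)
  ultimately show False using assms(2) t by metis
qed

text \<open>Orthogonality of characters: translating the summation variable by \<open>c\<close>
  multiplies the sum by \<open>chi x c\<close>, which can be chosen different from 1 when
  \<open>x\<close> is outside the dual.\<close>

lemma sum_chi:
  fixes C :: "('a ^ 'n::finite) set"
  assumes C: "vec.subspace C"
  shows "(\<Sum>y\<in>C. chi x y) = (if x \<in> euclidean_dual C then of_nat (card C) else 0)"
proof (cases "x \<in> euclidean_dual C")
  case True
  then show ?thesis by (simp add: chi_eq_1)
next
  case False
  then obtain c where c: "c \<in> C" "chi x c \<noteq> 1" using mem_dual_if_chi_eq_1[OF C] by blast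
  have "(\<Sum>y\<in>C. chi x y) = (\<Sum>y\<in>C. chi x (y + c))"
    by (rule sum.reindex_bij_witness[of _ "\<lambda>y. y + c" "\<lambda>y. y - c"])
      (use C c in \<open>auto intro: vec.subspace_add vec.subspace_diff\<close>)
  also have "\<dots> = (\<Sum>y\<in>C. chi x y) * chi x c"
    by (simp add: chi_add_right sum_distrib_right)
  finally have "(\<Sum>y\<in>C. chi x y) * (chi x c - 1) = 0" by (simp add: algebra_simps)
  then show ?thesis using c False by simp
qed

text \<open>Double counting of the sum of \<open>chi x y\<close> over all \<open>x\<close> and all
  \<open>y\<close> in \<open>C\<close>: in one order only dual vectors \<open>x\<close> contribute,
  in the other only \<open>y = 0\<close>.\<close>

lemma card_euclidean_dual:
  fixes C :: "('a ^ 'n::finite) set"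
  assumes C: "vec.subspace C"
  shows "card C * card (euclidean_dual C) = CARD('a) ^ CARD('n)"
proof -
  have "of_nat (card C * card (euclidean_dual C)) = (\<Sum>x\<in>UNIV. \<Sum>y\<in>C. chi x y)"
    by (simp add: sum_chi[OF C] sum.If_cases)
  also have "\<dots> = (\<Sum>y\<in>C. \<Sum>x\<in>UNIV. chi y x)"
    by (subst sum.swap) (simp add: chi_commute)
  also have "\<dots> = (\<Sum>y\<in>C. if y = 0 then of_nat CARD('a ^ 'n) else 0)"
    by (simp add: sum_chi[OF vec.subspace_UNIV] euclidean_dual_UNIV)
  also have "\<dots> = of_nat (CARD('a) ^ CARD('n))"
    using vec.subspace_0[OF C] by simp
  finally show ?thesis by (simp only: of_nat_eq_iff)
qed

section \<open>Action of the error operators on coordinates\<close>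

lemma zeta_trace_sum: "finite I \<Longrightarrow> zeta_trace (\<Sum>i\<in>I. f i :: 'a) = (\<Prod>i\<in>I. zeta_trace (f i))"
  by (induction I rule: finite_induct) (simp_all add: zeta_trace_0 zeta_trace_add[OF card_eq])

lemma X_tensor_apply: "(X_tensor a *v \<psi>) $ y = \<psi> $ (y - a)" for a :: "'a ^ 'n::finite"
proof -
  have *: "X_tensor a $ y $ x = (if x = y - a then 1 else 0)" for x
  proof -
    have "X_tensor a $ y $ x = (if y = x + a then 1 else 0)"
      using arg_cong[OF X_tensor_ket[of a x], of "\<lambda>u. u $ y"]
      unfolding mult_ket by (simp add: column_def axis_def)
    then show ?thesis by (auto simp: algebra_simps)
  qed
  show ?thesis by (simp add: matrix_vector_mult_def * if_distrib if_distribR cong: if_cong)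
qed

lemma Z_tensor_apply: "(Z_tensor b *v \<psi>) $ y = chi b y * \<psi> $ y" for b :: "'a ^ 'n::finite"
proof -
  have *: "Z_tensor b $ y $ x = (if x = y then chi b y else 0)" for x
    using arg_cong[OF Z_tensor_ket[of b x], of "\<lambda>u. u $ y"]
    unfolding mult_ket by (auto simp: column_def axis_def chi_def zeta_trace_sum)
  show ?thesis by (simp add: matrix_vector_mult_def * if_distrib if_distribR cong: if_cong)
qed

end

lemma mat_mult_vec: "mat c *v x = c *s x"
  by (simp add: vec_eq_iff matrix_vector_mult_def mat_def if_distrib if_distribR cong: if_cong)

lemma (in trace_character) pauli_apply:
  fixes a b :: "'a ^ 'n::finite"
  shows "(pauli c a b *v \<psi>) $ y = zeta TYPE('a) ^ c * chi b (y - a) * \<psi> $ (y - a)"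
  by (simp add: pauli_def mat_mult_vec X_tensor_apply Z_tensor_apply
      flip: matrix_vector_mul_assoc)

section \<open>The stabilizer code of a self-orthogonal code\<close>

definition css_space :: "('a::finite_field ^ 'n::finite) set \<Rightarrow> ('a, 'n) state set" where
  "css_space C =
     {\<psi>. (\<forall>x. x \<notin> euclidean_dual C \<longrightarrow> \<psi> $ x = 0) \<and> (\<forall>x. \<forall>a\<in>C. \<psi> $ (x + a) = \<psi> $ x)}"

definition coset :: "('a::finite_field ^ 'n::finite) set \<Rightarrow> 'a ^ 'n \<Rightarrow> ('a ^ 'n) set" where
  "coset C x = {y. y - x \<in> C}"

definition coset_state :: "('a::finite_field ^ 'n::finite) set \<Rightarrow> 'a ^ 'n \<Rightarrow> ('a, 'n) state" where
  "coset_state C x = (\<chi> y. if y \<in> coset C x then 1 else 0)"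

text \<open>This is restriction to the dual followed by averaging over \<open>C\<close>. When
  \<open>C\<close> is self-orthogonal, the dual is a union of cosets of \<open>C\<close>, so testing
  \<open>x\<close> alone still gives a symmetric matrix.\<close>

definition css_projector :: "('a::finite_field ^ 'n::finite) set \<Rightarrow> ('a, 'n) operator" where
  "css_projector C =
     (\<chi> y x. if x \<in> euclidean_dual C \<and> y - x \<in> C then 1 / of_nat (card C) else 0)"

locale self_orthogonal_code = trace_character m "TYPE('a)"
  for m :: nat and C :: "('a::finite_field ^ 'n::finite) set" +
  assumes subspace: "vec.subspace C"
    and self_orthogonal: "C \<subseteq> euclidean_dual C"
begin

abbreviation "D \<equiv> euclidean_dual C"

lemma zero_mem: "0 \<in> C"
  using subspace by (rule vec.subspace_0)

lemma card_pos: "card C > 0"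
  using zero_mem by (auto simp: card_gt_0_iff)

lemma minus_mem_iff: "x - y \<in> C \<longleftrightarrow> y - x \<in> C"
  using vec.subspace_neg[OF subspace, of "x - y"] vec.subspace_neg[OF subspace, of "y - x"] by auto

lemma dual_cong: "x - y \<in> C \<Longrightarrow> x \<in> D \<longleftrightarrow> y \<in> D"
  using vec.subspace_add[OF euclidean_dual_subspace[of C], of "x - y" y] self_orthogonal
    vec.subspace_diff[OF euclidean_dual_subspace[of C], of x "x - y"]
  by auto

lemma chi_C: "x \<in> C \<Longrightarrow> y \<in> C \<Longrightarrow> chi x y = 1"
  using self_orthogonal chi_eq_1 by blast

section \<open>The stabilizer group and its fixed space\<close>

definition stabilizer :: "('a, 'n) operator set" where
  "stabilizer = {pauli 0 a b | a b. a \<in> C \<and> b \<in> C}"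

text \<open>Moving \<open>Z_tensor b\<close> past \<open>X_tensor a'\<close> produces the phase
  \<open>chi b a'\<close>, which self-orthogonality makes 1. Hence the phase exponent stays
  0.\<close>

lemma pauli_mult:
  assumes "b \<in> C" "a' \<in> C"
  shows "pauli 0 a b ** pauli 0 a' b' = pauli 0 (a + a') (b + b')"
  unfolding matrix_eq vec_eq_iff
proof (intro allI)
  fix \<psi> :: "('a, 'n) state" and y
  have "chi b (y - a) = chi b (y - a - a') * chi b a'"
    by (simp flip: chi_add_right)
  then show "((pauli 0 a b ** pauli 0 a' b') *v \<psi>) $ y = (pauli 0 (a + a') (b + b') *v \<psi>) $ y"
    by (simp add: pauli_apply chi_C[OF assms] chi_add_left diff_diff_eq
        flip: matrix_vector_mul_assoc)
qed

lemma pauli_0: "pauli 0 0 0 = (mat 1 :: ('a, 'n) operator)"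
  by (simp add: matrix_eq vec_eq_iff pauli_apply chi_0)

lemma stabilizer_subgroup: "subgroup stabilizer error_group"
proof
  show "stabilizer \<subseteq> carrier error_group"
    by (auto simp: stabilizer_def error_group_def)
  show "\<one>\<^bsub>error_group\<^esub> \<in> stabilizer"
    using zero_mem by (auto simp: stabilizer_def error_group_def simp flip: pauli_0)
  show "x \<otimes>\<^bsub>error_group\<^esub> y \<in> stabilizer" if "x \<in> stabilizer" "y \<in> stabilizer" for x y
    using that vec.subspace_add[OF subspace]
    by (fastforce simp: stabilizer_def error_group_def pauli_mult)
  show "inv\<^bsub>error_group\<^esub> x \<in> stabilizer" if "x \<in> stabilizer" for x
  proof -
    from that obtain a b where ab: "a \<in> C" "b \<in> C" and x: "x = pauli 0 a b"
      by (auto simp: stabilizer_def)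
    let ?y = "pauli 0 (- a) (- b)"
    have ab': "- a \<in> C" "- b \<in> C" using ab by (auto intro: vec.subspace_neg[OF subspace])
    have *: "x ** ?y = mat 1" "?y ** x = mat 1"
      using ab ab' by (simp_all add: x pauli_mult pauli_0)
    \<comment> \<open>The inverse is computed from its defining description, with uniqueness checked
      by matrix multiplication.\<close>
    have "inv\<^bsub>error_group\<^esub> x = ?y"
      unfolding m_inv_def
    proof (rule the_equality)
      show "?y \<in> carrier error_group \<and> x \<otimes>\<^bsub>error_group\<^esub> ?y = \<one>\<^bsub>error_group\<^esub> \<and>
          ?y \<otimes>\<^bsub>error_group\<^esub> x = \<one>\<^bsub>error_group\<^esub>"
        using * by (auto simp: error_group_def)
    next
      fix z assume "z \<in> carrier error_group \<and> x \<otimes>\<^bsub>error_group\<^esub> z = \<one>\<^bsub>error_group\<^esub> \<and>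
          z \<otimes>\<^bsub>error_group\<^esub> x = \<one>\<^bsub>error_group\<^esub>"
      then have "x ** z = mat 1" by (simp add: error_group_def)
      then have "?y ** (x ** z) = ?y" by simp
      then show "z = ?y" by (simp add: matrix_mul_assoc *)
    qed
    then show ?thesis using ab' by (auto simp: stabilizer_def)
  qed
qed

lemma stabilizer_commute: "A \<in> stabilizer \<Longrightarrow> B \<in> stabilizer \<Longrightarrow> A ** B = B ** A"
  by (auto simp: stabilizer_def pauli_mult add.commute)

text \<open>The pure \<open>Z\<close> elements force the support into the dual, and the pure
  \<open>X\<close> elements force constancy on cosets.\<close>

lemma joint_fixed_space_stabilizer: "joint_fixed_space stabilizer = css_space C"
proof (intro subset_antisym subsetI)
  fix \<psi> assume "\<psi> \<in> joint_fixed_space stabilizer"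
  then have fixed: "pauli 0 a b *v \<psi> = \<psi>" if "a \<in> C" "b \<in> C" for a b
    using that by (auto simp: joint_fixed_space_def stabilizer_def)
  have "\<psi> $ x = 0" if x: "x \<notin> D" for x
  proof -
    obtain b where b: "b \<in> C" "chi x b \<noteq> 1"
      using mem_dual_if_chi_eq_1[OF subspace] x by blast
    have "chi b x * \<psi> $ x = \<psi> $ x"
      using arg_cong[OF fixed[OF zero_mem b(1)], of "\<lambda>u. u $ x"] by (simp add: pauli_apply)
    then show ?thesis using b by (simp add: chi_commute)
  qed
  moreover have "\<psi> $ (x + a) = \<psi> $ x" if "a \<in> C" for x a
    using arg_cong[OF fixed[OF that zero_mem], of "\<lambda>u. u $ (x + a)"] by (simp add: pauli_apply chi_0)
  ultimately show "\<psi> \<in> css_space C" by (simp add: css_space_def)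
next
  fix \<psi> assume \<psi>: "\<psi> \<in> css_space C"
  have "(pauli 0 a b *v \<psi>) $ y = \<psi> $ y" if ab: "a \<in> C" "b \<in> C" for a b y
  proof -
    have "\<psi> $ y = \<psi> $ (y - a)"
      using \<psi> ab(1) unfolding css_space_def by (metis (mono_tags, lifting) diff_add_cancel mem_Collect_eq)
    moreover have "chi b (y - a) = 1" if "y - a \<in> D"
      using chi_eq_1[OF that ab(2)] by (simp add: chi_commute)
    moreover have "\<psi> $ (y - a) = 0" if "y - a \<notin> D"
      using \<psi> that by (simp add: css_space_def)
    ultimately show ?thesis by (auto simp: pauli_apply)
  qed
  then have "pauli 0 a b *v \<psi> = \<psi>" if "a \<in> C" "b \<in> C" for a b
    using that by (simp add: vec_eq_iff)
  then show "\<psi> \<in> joint_fixed_space stabilizer"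
    by (auto simp: joint_fixed_space_def stabilizer_def)
qed

section \<open>A basis of coset states and the dimension\<close>

lemma coset_state_mem: "x \<in> D \<Longrightarrow> coset_state C x \<in> css_space C"
proof -
  assume x: "x \<in> D"
  have "y \<in> D" if "y - x \<in> C" for y using dual_cong[OF that] x by simp
  moreover have "y + a - x \<in> C \<longleftrightarrow> y - x \<in> C" if "a \<in> C" for y a
  proof -
    have "y - x + a = y + a - x" by simp
    then show ?thesis
      using vec.subspace_add[OF subspace _ that, of "y - x"]
        vec.subspace_diff[OF subspace _ that, of "y + a - x"] by (auto simp: algebra_simps)
  qed
  ultimately show ?thesis by (auto simp: css_space_def coset_state_def coset_def)
qed

lemma coset_state_self: "coset_state C x $ x = 1"
  by (simp add: coset_state_def coset_def zero_mem)

lemma stabilizer_code_css_space: "stabilizer_code (css_space C)"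
proof -
  have "coset_state C 0 \<in> css_space C"
    using vec.subspace_0[OF euclidean_dual_subspace] by (rule coset_state_mem)
  moreover have "coset_state C 0 \<noteq> 0" using coset_state_self[of 0] by auto
  ultimately have "css_space C \<noteq> {0}" by blast
  then show ?thesis
    unfolding stabilizer_code_def
    using stabilizer_subgroup stabilizer_commute joint_fixed_space_stabilizer by metis
qed

lemma coset_eq_iff: "coset C x = coset C y \<longleftrightarrow> x - y \<in> C"
proof
  assume "coset C x = coset C y"
  moreover have "x \<in> coset C x" by (simp add: coset_def zero_mem)
  ultimately have "x \<in> coset C y" by simp
  then show "x - y \<in> C" by (simp add: coset_def)
next
  assume xy: "x - y \<in> C"
  have "z - x \<in> C \<longleftrightarrow> z - y \<in> C" for z
    using vec.subspace_add[OF subspace _ xy, of "z - x"]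
      vec.subspace_diff[OF subspace _ xy, of "z - y"] by auto
  then show "coset C x = coset C y" by (auto simp: coset_def)
qed

lemma card_coset: "card (coset C x) = card C"
proof -
  have "bij_betw (\<lambda>y. y - x) (coset C x) C"
    by (rule bij_betwI[of _ _ _ "\<lambda>c. c + x"]) (auto simp: coset_def)
  then show ?thesis by (rule bij_betw_same_card)
qed

text \<open>The cosets of \<open>C\<close> partition \<open>D\<close> into blocks of size
  \<open>card C\<close>, and a coset is determined by its indicator vector.\<close>

lemma card_coset_states: "card C * card (coset_state C ` D) = card D"
proof -
  have "card C * card (coset C ` D) = card (\<Union> (coset C ` D))"
  proof (rule card_partition)
    fix K L assume "K \<in> coset C ` D" "L \<in> coset C ` D" "K \<noteq> L"
    then obtain x y where xy: "K = coset C x" "L = coset C y" "x - y \<notin> C"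
      by (metis coset_eq_iff imageE)
    have False if "z - x \<in> C" "z - y \<in> C" for z
      using xy(3) vec.subspace_diff[OF subspace that(2) that(1)] by simp
    then show "K \<inter> L = {}" by (auto simp: xy coset_def)
  qed (auto simp: card_coset)
  also have "\<Union> (coset C ` D) = D"
    using dual_cong zero_mem by (auto simp: coset_def intro!: bexI)
  also have "card (coset C ` D) = card (coset_state C ` D)"
  proof -
    have "coset_state C ` D = (\<lambda>K. \<chi> y. if y \<in> K then 1 else 0) ` coset C ` D"
      by (auto simp: coset_state_def)
    moreover have "inj (\<lambda>K :: ('a ^ 'n) set. (\<chi> y. if y \<in> K then 1 else 0) :: ('a, 'n) state)"
      by (rule injI) (auto simp: vec_eq_iff split: if_splits)
    ultimately show ?thesis by (metis card_image inj_on_subset subset_UNIV)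
  qed
  finally show ?thesis .
qed

lemma dim_css_space: "card C * vec.dim (css_space C) = card D"
proof -
  let ?B = "coset_state C ` D"
  have "vec.dim (css_space C) = card ?B"
  proof (rule vec.dim_unique)
    show "?B \<subseteq> css_space C" using coset_state_mem by auto
    show "css_space C \<subseteq> vec.span ?B"
    proof
      fix \<psi> assume \<psi>: "\<psi> \<in> css_space C"
      \<comment> \<open>Summing over all of \<open>D\<close> meets each coset \<open>card C\<close>
        times. Dividing by \<open>card C\<close> compensates and avoids a choice of
        representatives.\<close>
      have "\<psi> = (\<Sum>x\<in>D. (\<psi> $ x / of_nat (card C)) *s coset_state C x)"
        unfolding vec_eq_iff
      proof
        fix y
        have "(\<Sum>x\<in>D. (\<psi> $ x / of_nat (card C)) *s coset_state C x) $ y =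
            (\<Sum>x\<in>D. if x \<in> coset C y then \<psi> $ x / of_nat (card C) else 0)"
          by (simp add: coset_state_def coset_def minus_mem_iff if_distrib cong: if_cong)
        also have "\<dots> = (\<Sum>x\<in>D \<inter> coset C y. \<psi> $ x / of_nat (card C))"
          by (simp add: sum.inter_restrict)
        also have "\<dots> = (\<Sum>x\<in>coset C y. \<psi> $ y / of_nat (card C))"
        proof (rule sum.mono_neutral_cong_left)
          have const: "\<psi> $ x = \<psi> $ y" if "x \<in> coset C y" for x
          proof -
            have "\<psi> $ (y + (x - y)) = \<psi> $ y" using \<psi> that unfolding css_space_def coset_def by blast
            then show ?thesis by simp
          qed
          show "\<And>x. x \<in> D \<inter> coset C y \<Longrightarrow> \<psi> $ x / of_nat (card C) = \<psi> $ y / of_nat (card C)"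
            using const by simp
          show "\<forall>x\<in>coset C y - D \<inter> coset C y. \<psi> $ y / of_nat (card C) = 0"
            using \<psi> dual_cong by (auto simp: css_space_def coset_def)
        qed auto
        also have "\<dots> = \<psi> $ y" using zero_mem by (auto simp: card_coset)
        finally show "\<psi> $ y = (\<Sum>x\<in>D. (\<psi> $ x / of_nat (card C)) *s coset_state C x) $ y" ..
      qed
      also have "\<dots> \<in> vec.span ?B"
        by (intro vec.span_sum vec.span_scale vec.span_base imageI)
      finally show "\<psi> \<in> vec.span ?B" .
    qed
    show "vec.independent ?B"
    proof (rule vec.independent_if_scalars_zero)
      fix f v assume sum0: "(\<Sum>v\<in>?B. f v *s v) = 0" and "v \<in> ?B"
      then obtain x where x: "x \<in> D" "v = coset_state C x" by auto
      \<comment> \<open>Distinct coset states have disjoint supports, so the coordinate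
        \<open>x\<close> isolates the coefficient of \<open>v\<close>.\<close>
      have "w $ x = 0" if "w \<in> ?B" "w \<noteq> v" for w
      proof -
        obtain z where z: "z \<in> D" "w = coset_state C z" using \<open>w \<in> ?B\<close> by auto
        then have "coset C x \<noteq> coset C z" using that x by (auto simp: coset_state_def)
        then have "x - z \<notin> C" by (simp add: coset_eq_iff)
        then show ?thesis using z by (simp add: coset_state_def coset_def)
      qed
      then have "(\<Sum>w\<in>?B. f w *s w) $ x = (\<Sum>w\<in>?B. if w = v then f v else 0)"
        unfolding sum_component by (intro sum.cong) (auto simp: x coset_state_self)
      then show "f v = 0" using \<open>v \<in> ?B\<close> sum0 by simp
    qed simp
  qed simp
  then show ?thesis using card_coset_states by simp
qed

section \<open>The projector, detectability and distance\<close>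

lemma css_projector_apply:
  "(css_projector C *v \<psi>) $ y = (if y \<in> D then (\<Sum>c\<in>C. \<psi> $ (y + c)) / of_nat (card C) else 0)"
proof -
  have "(css_projector C *v \<psi>) $ y =
      (\<Sum>x\<in>UNIV. if x \<in> {x. x \<in> D \<and> y - x \<in> C} then \<psi> $ x / of_nat (card C) else 0)"
    by (simp add: css_projector_def matrix_vector_mult_def if_distrib if_distribR cong: if_cong)
  also have "\<dots> = (\<Sum>x | x \<in> D \<and> y - x \<in> C. \<psi> $ x / of_nat (card C))"
    by (subst sum.inter_restrict[symmetric]) auto
  also have "{x. x \<in> D \<and> y - x \<in> C} = (if y \<in> D then coset C y else {})"
    using dual_cong by (auto simp: coset_def minus_mem_iff)
  also have "(\<Sum>x\<in>\<dots>. \<psi> $ x / of_nat (card C)) =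
      (if y \<in> D then (\<Sum>x\<in>coset C y. \<psi> $ x) / of_nat (card C) else 0)"
    by (simp add: sum_divide_distrib)
  also have "(\<Sum>x\<in>coset C y. \<psi> $ x) = (\<Sum>c\<in>C. \<psi> $ (y + c))"
    by (rule sum.reindex_bij_witness[of _ "\<lambda>c. y + c" "\<lambda>x. x - y"]) (auto simp: coset_def)
  finally show ?thesis .
qed

lemma css_projector_fixes: "\<psi> \<in> css_space C \<Longrightarrow> css_projector C *v \<psi> = \<psi>"
  using card_pos by (auto simp: vec_eq_iff css_projector_apply css_space_def)

lemma css_projector_mem: "css_projector C *v \<psi> \<in> css_space C"
proof -
  have "(\<Sum>c\<in>C. \<psi> $ (y + a + c)) = (\<Sum>c\<in>C. \<psi> $ (y + c))" if "a \<in> C" for y a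
    by (rule sum.reindex_bij_witness[of _ "\<lambda>c. c - a" "\<lambda>c. a + c"])
      (use that in \<open>auto simp: algebra_simps intro: vec.subspace_add[OF subspace] vec.subspace_diff[OF subspace]\<close>)
  moreover have "y + a \<in> D \<longleftrightarrow> y \<in> D" if "a \<in> C" for y a
    by (rule dual_cong) (use that in simp)
  ultimately show ?thesis by (auto simp: css_space_def css_projector_apply)
qed

lemma orthogonal_projector_css: "orthogonal_projector (css_projector C) (css_space C)"
  unfolding orthogonal_projector_def
proof (intro conjI allI)
  show "css_projector C ** css_projector C = css_projector C"
    by (simp add: matrix_eq css_projector_fixes css_projector_mem flip: matrix_vector_mul_assoc)
  show "css_projector C $ i $ j = cnj (css_projector C $ j $ i)" for i j
    using dual_cong[of i j] by (auto simp: css_projector_def minus_mem_iff)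
  show "range (\<lambda>\<psi>. css_projector C *v \<psi>) = css_space C"
    using css_projector_mem css_projector_fixes by (metis rangeI image_subsetI subsetI subset_antisym)
qed

text \<open>With both vectors in \<open>C\<close> the error is a phase times a stabilizer element.
  Otherwise the projector kills the image of the code: for \<open>b\<close> outside \<open>D\<close>
  by a vanishing character sum, for \<open>a\<close> outside \<open>D\<close> because the support is
  moved off \<open>D\<close>.\<close>

lemma css_detectable:
  assumes "a \<in> C \<and> b \<in> C \<or> a \<notin> D \<or> b \<notin> D"
  shows "detectable (css_space C) (pauli c a b)"
proof -
  let ?P = "css_projector C" and ?E = "pauli c a b"
  have "\<exists>k. \<forall>\<psi>\<in>css_space C. ?P *v (?E *v \<psi>) = k *s \<psi>"
  proof (cases "a \<in> C \<and> b \<in> C")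
    case True
    have "?E *v \<psi> = zeta TYPE('a) ^ c *s \<psi>" if "\<psi> \<in> css_space C" for \<psi>
    proof -
      have "pauli 0 a b *v \<psi> = \<psi>"
        using that True unfolding joint_fixed_space_stabilizer[symmetric]
        by (auto simp: joint_fixed_space_def stabilizer_def)
      then show ?thesis by (simp add: vec_eq_iff pauli_apply mult.assoc)
    qed
    then show ?thesis by (auto simp: vec.scale css_projector_fixes)
  next
    case False
    have "(?P *v (?E *v \<psi>)) $ y = 0" if \<psi>: "\<psi> \<in> css_space C" for \<psi> y
    proof (cases "y \<in> D")
      case y: True
      have shift: "\<psi> $ (y + e - a) = \<psi> $ (y - a)" if "e \<in> C" for e
      proof -
        have "\<psi> $ (y - a + e) = \<psi> $ (y - a)" using \<psi> that by (simp add: css_space_def)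
        then show ?thesis by (simp add: algebra_simps)
      qed
      have chi_shift: "chi b (y + e - a) = chi b (y - a) * chi b e" for e
        by (simp add: algebra_simps flip: chi_add_right)
      \<comment> \<open>Along the coset of \<open>y\<close> only the character varies with
        \<open>e\<close>, so everything else factors out.\<close>
      have "(\<Sum>e\<in>C. (?E *v \<psi>) $ (y + e)) =
          zeta TYPE('a) ^ c * chi b (y - a) * \<psi> $ (y - a) * (\<Sum>e\<in>C. chi b e)"
        unfolding sum_distrib_left
        by (intro sum.cong refl) (simp add: pauli_apply shift chi_shift)
      also have "\<dots> = 0"
      proof (cases "b \<in> D")
        case True
        with assms False have "a \<notin> D" by blast
        then have "y - a \<notin> D"
          using vec.subspace_diff[OF euclidean_dual_subspace y, of "y - a"] by auto
        then show ?thesis using \<psi> by (simp add: css_space_def)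
      qed (simp add: sum_chi[OF subspace])
      finally show ?thesis by (simp add: css_projector_apply)
    qed (simp add: css_projector_apply)
    then have "?P *v (?E *v \<psi>) = 0 *s \<psi>" if "\<psi> \<in> css_space C" for \<psi>
      using that by (simp add: vec_eq_iff)
    then show ?thesis by blast
  qed
  \<comment> \<open>Every projected vector lies in the code, so a scalar valid on the code gives an
    identity of operators.\<close>
  then obtain k where "\<And>\<psi>. ?P *v (?E *v (?P *v \<psi>)) = k *s (?P *v \<psi>)"
    using css_projector_mem by blast
  then have "?P ** ?E ** ?P = mat k ** ?P"
    by (simp add: matrix_eq mat_mult_vec flip: matrix_vector_mul_assoc)
  then show ?thesis unfolding detectable_def using orthogonal_projector_css by blast
qed

text \<open>The error sends the state of the coset \<open>C\<close> to that of the different coset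
  \<open>a + C\<close>. Both are code vectors, so the compressed error is not a scalar.\<close>

lemma css_not_detectable:
  assumes a: "a \<in> D" "a \<notin> C"
  shows "\<not> detectable (css_space C) (pauli 0 a 0)"
proof
  let ?E = "pauli 0 a 0" and ?\<psi> = "coset_state C 0"
  assume "detectable (css_space C) ?E"
  then obtain P k where P: "orthogonal_projector P (css_space C)" and k: "P ** ?E ** P = mat k ** P"
    unfolding detectable_def by blast
  \<comment> \<open>\<open>detectable\<close> asserts the existence of some projector, so an
    arbitrary one has to be refuted. Idempotence and the range suffice.\<close>
  have P_fixes: "P *v \<psi> = \<psi>" if "\<psi> \<in> css_space C" for \<psi>
  proof -
    note P' = P[unfolded orthogonal_projector_def]
    have PP: "P ** P = P" using P' by (rule conjunct1)
    have "range (\<lambda>\<psi>. P *v \<psi>) = css_space C" using P' by (elim conjE)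
    then have "\<psi> \<in> range (\<lambda>\<psi>. P *v \<psi>)" using that by (rule ssubst)
    then obtain \<phi> where \<phi>: "\<psi> = P *v \<phi>" by (rule rangeE)
    show ?thesis by (simp only: \<phi> matrix_vector_mul_assoc PP)
  qed
  have \<psi>: "?\<psi> \<in> css_space C"
    using vec.subspace_0[OF euclidean_dual_subspace] by (rule coset_state_mem)
  have E: "?E *v ?\<psi> = coset_state C a"
    by (simp add: vec_eq_iff pauli_apply chi_0 coset_state_def coset_def)
  have "P *v (?E *v (P *v ?\<psi>)) = k *s (P *v ?\<psi>)"
    using arg_cong[OF k, of "\<lambda>A. A *v ?\<psi>"] by (simp add: mat_mult_vec flip: matrix_vector_mul_assoc)
  then have "coset_state C a = k *s ?\<psi>"
    by (simp add: P_fixes \<psi> E coset_state_mem a)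
  \<comment> \<open>At coordinate \<open>a\<close> the left side is 1, while the right side is 0
    because \<open>a\<close> is not in \<open>C\<close>.\<close>
  from arg_cong[OF this, of "\<lambda>u. u $ a"] show False
    using a by (simp add: coset_state_self) (simp add: coset_state_def coset_def)
qed

text \<open>An undetectable error has \<open>x\<close> or \<open>y\<close> in \<open>D - C\<close>,
  and its weight bounds both Hamming weights. A lightest word of \<open>D - C\<close>, taken as a
  pure \<open>X\<close> error, attains the bound. The hypothesis makes the minimum range over a
  nonempty set.\<close>

lemma css_min_distance:
  assumes "C \<noteq> D"
  shows "has_min_distance (css_space C) (min_wt (D - C))"
proof -
  have ne: "D - C - {0} = D - C" using zero_mem by auto
  have "D - C \<noteq> {}" using assms self_orthogonal by auto
  then have "min_wt (D - C) \<in> hamming_wt ` (D - C)"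
    unfolding min_wt_def ne by (intro Min_in) auto
  then obtain a where a: "a \<in> D" "a \<notin> C" "min_wt (D - C) = hamming_wt a" by auto
  have le: "min_wt (D - C) \<le> hamming_wt x" if "x \<in> D" "x \<notin> C" for x
    unfolding min_wt_def ne using that by (intro Min_le) auto
  have wt: "hamming_wt a \<le> pauli_wt a b" "hamming_wt b \<le> pauli_wt a b" for a b :: "'a ^ 'n"
    by (auto simp: hamming_wt_def pauli_wt_def intro!: card_mono)
  have "detects_below (css_space C) (min_wt (D - C))"
    unfolding detects_below_def
  proof (intro allI impI)
    fix c :: nat and x y :: "'a ^ 'n" assume lt: "pauli_wt x y < min_wt (D - C)"
    have "x \<notin> D \<or> x \<in> C" using le[of x] wt(1)[of x y] lt by fastforce
    moreover have "y \<notin> D \<or> y \<in> C" using le[of y] wt(2)[of y x] lt by fastforce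
    ultimately show "detectable (css_space C) (pauli c x y)"
      by (intro css_detectable) blast
  qed
  moreover have "d' \<le> min_wt (D - C)" if "detects_below (css_space C) d'" for d'
  proof (rule ccontr)
    assume "\<not> ?thesis"
    moreover have "pauli_wt a 0 = hamming_wt a" by (simp add: pauli_wt_def hamming_wt_def)
    ultimately have "detectable (css_space C) (pauli 0 a 0)"
      using that a unfolding detects_below_def by simp
    then show False using css_not_detectable a by blast
  qed
  ultimately show ?thesis unfolding has_min_distance_def by blast
qed

end

text \<open>The dual has Q^(k+K) elements, so the quotient by \<open>C\<close> has Q^K. Positivity
  of \<open>K\<close> separates \<open>C\<close> from its dual, as the distance requires.\<close>

theorem css_code_params:
  fixes C :: "('a::finite_field ^ 'n::finite) set"
  assumes "CARD('a) = CHAR('a) ^ m" and "vec.subspace C" and "C \<subseteq> euclidean_dual C"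
    and C: "card C = CARD('a) ^ k" and n: "CARD('n) = 2 * k + K" and "K > 0"
  shows "stabilizer_code_params (css_space C) (CARD('n)) K (min_wt (euclidean_dual C - C)) (CARD('a))"
proof -
  interpret self_orthogonal_code m C by unfold_locales fact+
  have Q: "CARD('a) > 1"
    using card_mono[of UNIV "{0, 1 :: 'a}"] by simp
  have "card C * card D = CARD('a) ^ k * (CARD('a) ^ (k + K))"
    using card_euclidean_dual[OF subspace] by (simp add: n mult_2 add.assoc flip: power_add)
  then have D: "card D = CARD('a) ^ (k + K)" using Q by (simp add: C)
  then have "vec.dim (css_space C) = CARD('a) ^ K"
    using dim_css_space Q by (simp add: C power_add)
  moreover have "C \<noteq> D"
  proof
    assume "C = D"
    then have "CARD('a) ^ k = CARD('a) ^ (k + K)" using C D by simp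
    then show False using Q \<open>K > 0\<close> by simp
  qed
  ultimately show ?thesis
    unfolding stabilizer_code_params_def
    using stabilizer_code_css_space css_min_distance by simp
qed

section \<open>The residue functional of a split polynomial\<close>

text \<open>In the product rule every summand but the one omitting the factor of index
  \<open>i\<close> vanishes at \<open>\<alpha> i\<close>.\<close>

lemma poly_pderiv_prod_linear:
  fixes \<alpha> :: "'i::finite \<Rightarrow> 'a::field"
  shows "poly (pderiv (\<Prod>i\<in>UNIV. [:- \<alpha> i, 1:])) (\<alpha> i) = (\<Prod>j\<in>UNIV - {i}. \<alpha> i - \<alpha> j)"
proof -
  have "poly (pderiv (\<Prod>i\<in>UNIV. [:- \<alpha> i, 1:])) (\<alpha> i) =
      (\<Sum>l\<in>UNIV. \<Prod>j\<in>UNIV - {l}. \<alpha> i - \<alpha> j)"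
    by (simp add: pderiv_prod poly_sum pderiv_pCons poly_prod)
  also have "\<dots> = (\<Sum>l\<in>{i}. \<Prod>j\<in>UNIV - {l}. \<alpha> i - \<alpha> j)"
    by (rule sum.mono_neutral_right) auto
  finally show ?thesis by simp
qed

text \<open>The polynomials \<open>e i\<close> below are monic of degree one less than the number of
  nodes and take the value g'(\<alpha> i) at their own node. Comparing top coefficients in the
  interpolation formula gives the claim.\<close>

lemma lagrange_coeff_sum:
  fixes \<alpha> :: "'i::finite \<Rightarrow> 'a::field" and f :: "'a poly"
  assumes inj: "inj \<alpha>" and f: "degree f < CARD('i)"
  defines "g \<equiv> \<Prod>i\<in>UNIV. [:- \<alpha> i, 1:]"
  shows "(\<Sum>i\<in>UNIV. inverse (poly (pderiv g) (\<alpha> i)) * poly f (\<alpha> i)) = coeff f (CARD('i) - 1)"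
proof -
  define e where "e i = (\<Prod>j\<in>UNIV - {i}. [:- \<alpha> j, 1:])" for i
  have deriv: "poly (pderiv g) (\<alpha> i) = poly (e i) (\<alpha> i)" for i
    by (simp add: g_def e_def poly_pderiv_prod_linear poly_prod)
  have e_neq: "poly (e i) (\<alpha> i) \<noteq> 0" for i
    using inj by (auto simp: e_def poly_prod dest: injD)
  have e_root: "poly (e i) (\<alpha> j) = 0" if "i \<noteq> j" for i j
    using that by (auto simp: e_def poly_prod)
  have deg_e: "degree (e i) = CARD('i) - 1" for i
    by (simp add: e_def degree_prod_sum_eq card_Diff_subset)
  have "lead_coeff (e i) = 1" for i
    unfolding e_def by (simp add: lead_coeff_prod)
  then have coeff_e: "coeff (e i) (CARD('i) - 1) = 1" for i
    by (simp add: deg_e)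
  let ?h = "\<Sum>i\<in>UNIV. smult (inverse (poly (pderiv g) (\<alpha> i)) * poly f (\<alpha> i)) (e i)"
  have "f = ?h"
  proof (rule poly_eqI_degree)
    fix x assume "x \<in> range \<alpha>"
    then obtain j where j: "x = \<alpha> j" by auto
    have "poly ?h x = (\<Sum>i\<in>{j}. inverse (poly (pderiv g) (\<alpha> i)) * poly f (\<alpha> i) * poly (e i) x)"
      unfolding poly_sum poly_smult by (rule sum.mono_neutral_right) (auto simp: j e_root)
    then show "poly f x = poly ?h x" by (simp add: j deriv e_neq)
  next
    show "card (range \<alpha>) > degree f" using f by (simp add: card_image[OF inj])
    have "degree ?h \<le> CARD('i) - 1"
      by (intro degree_sum_le) (auto intro: order.trans[OF degree_smult_le] simp: deg_e)
    then show "card (range \<alpha>) > degree ?h" using f by (simp add: card_image[OF inj])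
  qed
  from arg_cong[OF this, of "\<lambda>p. coeff p (CARD('i) - 1)"] show ?thesis
    by (simp add: coeff_sum coeff_e[simplified])
qed

text \<open>Here \<open>L\<close> is any linear functional that kills multiples of \<open>g\<close>
  and reads off the top coefficient in low degree. Each mixed product contributes
  \<open>\<eta>\<close> and \<open>B * B\<close> contributes \<open>\<rho> ^ 2\<close>, up to the
  common factor of constant coefficients, and the total cancels.\<close>

lemma twisted_products_vanish:
  fixes L :: "'a::field poly \<Rightarrow> 'a" and g w :: "'a poly"
  assumes add: "\<And>f h. L (f + h) = L f + L h"
    and smult: "\<And>b f. L (smult b f) = b * L f"
    and low: "\<And>f. degree f \<le> 2 * k \<Longrightarrow> L f = coeff f (2 * k)"
    and mod: "\<And>f. L (g * f) = 0"
    and g: "g = pCons c w"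
    and w: "degree w = 2 * k" "lead_coeff w = 1" "coeff w 0 = 0"
    and \<rho>: "\<rho> ^ 2 = - 2 * \<eta>"
    and A: "degree A < k" and A': "degree A' < k"
  defines "B \<equiv> monom \<rho> k + smult \<eta> w"
  shows "L ((A + smult (coeff A 0) B) * (A' + smult (coeff A' 0) B)) = 0"
proof -
  \<comment> \<open>Modulo \<open>g\<close> the polynomial \<open>x w\<close> is the constant \<open>-c\<close>.\<close>
  have Xw: "L (pCons 0 (w * f)) = - c * L f" for f
  proof -
    have "L (g * f) = L (pCons 0 (w * f)) + L (smult c f)"
      by (simp add: g algebra_simps flip: add)
    then show ?thesis by (simp add: mod smult eq_neg_iff_add_eq_0)
  qed
  have vanish: "L f = 0" if "degree f < 2 * k" for f
    using that low[of f] coeff_eq_0[of f "2 * k"] by simp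
  have Lw: "L w = 1" using low[of w] w by simp
  have Lpow: "L (monom 1 k * f) = 0" if "degree f < k" for f :: "'a poly"
    using that degree_mult_le[of "monom 1 k" f] degree_monom_le[of "1 :: 'a" k]
    by (intro vanish) linarith
  have B: "B = smult \<rho> (monom 1 k) + smult \<eta> w"
    by (simp add: B_def smult_monom)
  \<comment> \<open>Split off the constant term, A = b + x * A1: the part with \<open>A1\<close>
    reduces to a multiple of \<open>L A1 = 0\<close>, leaving b * L w = b.\<close>
  have LA: "L (A * B) = \<eta> * coeff A 0" if "degree A < k" for A
  proof (cases A)
    case (pCons b A1)
    have "degree A1 < k" using that by (auto simp: pCons split: if_splits)
    then have "L A1 = 0" by (intro vanish) simp
    have "A * w = smult b w + pCons 0 (w * A1)" by (simp add: pCons mult.commute)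
    then have "L (A * w) = b" using \<open>L A1 = 0\<close> by (simp add: add smult Lw Xw)
    moreover have "A * B = smult \<rho> (monom 1 k * A) + smult \<eta> (A * w)"
      unfolding B by (simp add: distrib_left mult.commute del: smult_monom)
    ultimately show ?thesis using Lpow[OF that] by (simp add: add smult pCons)
  qed
  \<comment> \<open>The zero constant term of \<open>w\<close> frees a second factor x, so
    \<open>Xw\<close> applies to \<open>w * w\<close> as well.\<close>
  obtain w1 where w1: "w = pCons 0 w1" using w(3) by (cases w) auto
  have k: "k > 0" using A by simp
  then have "degree w1 < 2 * k" using w(1) by (auto simp: w1 split: if_splits)
  then have "L w1 = 0" by (rule vanish)
  moreover have "w * w = pCons 0 (w * w1)" using mult_pCons_right[of w 0 w1] by (simp flip: w1)
  ultimately have "L (w * w) = 0" using Xw[of w1] by simp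
  moreover have "L (monom 1 k * w) = 0"
  proof -
    obtain l where l: "k = Suc l" using k by (cases k) auto
    have "monom 1 k * w = pCons 0 (w * monom 1 l)" by (simp add: l monom_Suc mult.commute)
    moreover have "L (monom 1 l) = 0"
      using degree_monom_le[of "1 :: 'a" l] by (intro vanish) (simp add: l)
    ultimately show ?thesis by (simp add: Xw)
  qed
  moreover have "L (monom 1 (2 * k)) = 1" using low[of "monom 1 (2 * k)"] by (simp add: degree_monom_le)
  moreover have "B * B = smult (\<rho> * \<rho>) (monom 1 (2 * k)) + smult (\<rho> * \<eta>) (monom 1 k * w)
      + smult (\<rho> * \<eta>) (monom 1 k * w) + smult (\<eta> * \<eta>) (w * w)"
  proof -
    have M: "monom 1 (2 * k) = monom 1 k * (monom 1 k :: 'a poly)"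
      by (simp add: mult_monom mult_2)
    show ?thesis
      unfolding B M by (simp add: distrib_left distrib_right mult.commute del: smult_monom mult_monom)
  qed
  ultimately have LB: "L (B * B) = \<rho> ^ 2" by (simp only: add smult power2_eq_square mult_zero_right add_0_right mult_1_right)
  have "L (A * A') = 0"
    using degree_mult_le[of A A'] A A' by (intro vanish) linarith
  moreover have "(A + smult (coeff A 0) B) * (A' + smult (coeff A' 0) B) =
      A * A' + smult (coeff A' 0) (A * B) + smult (coeff A 0) (A' * B)
        + smult (coeff A 0 * coeff A' 0) (B * B)"
    by (simp add: algebra_simps)
  ultimately show ?thesis
    using LA[OF A] LA[OF A'] LB \<rho> by (simp add: add smult)
qed

section \<open>The twisted code and its parameters\<close>

lemma CHAR_eq_if_CARD_eq_power:
  assumes p: "prime p" and card: "CARD('a::finite_field) = p ^ m"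
  shows "CHAR('a) = p"
proof -
  \<comment> \<open>Translation by 1 permutes the field, so the field size is zero in the
    field.\<close>
  have "(\<Sum>x\<in>UNIV. x :: 'a) = (\<Sum>x\<in>UNIV. x + 1)"
    by (rule sum.reindex_bij_witness[of _ "\<lambda>x. x + 1" "\<lambda>x. x - 1"]) auto
  then have "of_nat CARD('a) = (0 :: 'a)" by (simp add: sum.distrib)
  then have "CHAR('a) dvd p ^ m" by (simp only: of_nat_eq_0_iff_char_dvd card)
  then have "CHAR('a) dvd p" using prime_dvd_power CHAR_prime by blast
  then show ?thesis using p by (simp add: primes_dvd_imp_eq)
qed

lemma monic_eq_prod_roots:
  fixes \<alpha> :: "'i::finite \<Rightarrow> 'a::field"
  assumes "inj \<alpha>" and "\<And>i. poly g (\<alpha> i) = 0" and "degree g = CARD('i)" and "lead_coeff g = 1"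
  shows "g = (\<Prod>i\<in>UNIV. [:- \<alpha> i, 1:])"
proof (rule poly_eqI_degree_lead_coeff[where A = "range \<alpha>" and n = "CARD('i)"])
  have deg: "degree (\<Prod>i\<in>UNIV. [:- \<alpha> i, 1:]) = CARD('i)"
    by (simp add: degree_prod_sum_eq)
  moreover have "lead_coeff (\<Prod>i\<in>UNIV. [:- \<alpha> i, 1:]) = 1"
    by (simp add: lead_coeff_prod)
  ultimately show "coeff g CARD('i) = coeff (\<Prod>i\<in>UNIV. [:- \<alpha> i, 1:]) CARD('i)"
    using assms by simp
  show "degree (\<Prod>i\<in>UNIV. [:- \<alpha> i, 1:]) \<le> CARD('i)" using deg by simp
qed (use assms in \<open>auto simp: card_image poly_prod\<close>)

theorem proposition37:
  fixes p s h t r q n :: nat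
    and Fq Fpt :: "'a::finite_field set"
    and a :: "nat \<Rightarrow> 'a" and c \<eta> \<rho> :: 'a
    and g :: "'a poly" and S2 :: "'a poly set"
    and \<alpha> v :: "'a ^ 'n::finite" and C2 :: "('a ^ 'n) set"
  assumes "prime p" and "odd p"
    and "s > 0" and "h > 0" and "t > 0" and "r > 0"
    and "odd r" and "t dvd h" and "s < h"
    and "q = p ^ h" and "q mod 8 = 1 \<or> q mod 8 = 3"
    and "n = r * p ^ s" and "CARD('n) = n"
    and "CARD('a) = q ^ 2"
    and "is_subfield Fq" and "card Fq = q"
    and "is_subfield Fpt" and "card Fpt = p ^ t"
    and "\<And>i. 1 \<le> i \<Longrightarrow> i \<le> (n - 1) div 2 \<Longrightarrow> a i \<in> Fpt \<and> a i \<noteq> 0"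
    and "c \<in> Fpt" and "c \<noteq> 0"
    and "g = monom 1 n + (\<Sum>i = 1..(n - 1) div 2. monom (a i) (n - i)) + [:c:]"
    and "is_splitting_field g Fpt Fq"
    and "range (\<lambda>i. \<alpha> $ i) = {x. poly g x = 0}" and "inj (\<lambda>i. \<alpha> $ i)"
    and "\<And>i. (v $ i) ^ 2 = inverse (poly (pderiv g) (\<alpha> $ i))"
    and "\<eta> \<in> Fq" and "\<eta> \<noteq> 0" and "\<eta> ^ ((q - 1) div 2) = 1"
    and "\<rho> \<in> Fq" and "\<rho> ^ 2 = - 2 * \<eta>"
    and "S2 = {(\<Sum>i = 0..(n - 3) div 2. monom (f i) i)
                 + monom (f 0 * \<rho>) ((n - 1) div 2)
                 + smult (f 0 * \<eta>)
                     ((\<Sum>j = 1..(n - 1) div 2. monom (a j) (n - 1 - j)) + monom 1 (n - 1))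
               | f :: nat \<Rightarrow> 'a. True}"
    and "C2 = ev \<alpha> v ` S2"
  shows "\<exists>V :: ('a, 'n) state set.
           stabilizer_code_params V (r * p ^ s) 1 (min_wt (euclidean_dual C2 - C2)) (q ^ 2)"
proof -
  note g = \<open>g = monom 1 n + (\<Sum>i = 1..(n - 1) div 2. monom (a i) (n - i)) + [:c:]\<close>
  note inj = \<open>inj (\<lambda>i. \<alpha> $ i)\<close>
  note v = \<open>\<And>i. (v $ i) ^ 2 = inverse (poly (pderiv g) (\<alpha> $ i))\<close>
  have card: "CARD('a) = CHAR('a) ^ (h * 2)"
    using CHAR_eq_if_CARD_eq_power[OF \<open>prime p\<close>, where 'a = 'a and m = "h * 2"]
      \<open>CARD('a) = q ^ 2\<close> \<open>q = p ^ h\<close> by (simp flip: power_mult)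
  define k where "k = (n - 1) div 2"
  have "p \<ge> 3" using prime_ge_2_nat[OF \<open>prime p\<close>] \<open>odd p\<close> by (cases "p = 2") auto
  moreover have "p dvd n" "n > 0" "odd n"
    using \<open>s > 0\<close> \<open>r > 0\<close> \<open>n = r * p ^ s\<close> \<open>odd r\<close> \<open>odd p\<close> \<open>p \<ge> 3\<close> by auto
  ultimately have n: "n = 2 * k + 1" and k: "k > 0"
    using dvd_imp_le[of p n] by (auto simp: k_def elim!: oddE)
  \<comment> \<open>This is the quotient of g - c by x.\<close>
  define w where "w = (\<Sum>j = 1..k. monom (a j) (2 * k - j)) + monom 1 (2 * k)"
  \<comment> \<open>The exponents \<open>2 * k - j\<close> lie between \<open>k\<close> and
    \<open>2 * k - 1\<close>: below \<open>k\<close> nothing occurs, and the top term is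
    untouched.\<close>
  have coeff_w: "coeff w i = (if i = 2 * k then 1 else 0)" if "i < k \<or> i \<ge> 2 * k" for i
  proof -
    have "(\<Sum>j = 1..k. coeff (monom (a j) (2 * k - j)) i) = 0"
      using that by (intro sum.neutral) auto
    then show ?thesis by (auto simp: w_def coeff_sum)
  qed
  have deg_w: "degree w = 2 * k"
  proof (rule antisym)
    show "degree w \<le> 2 * k" by (rule degree_le) (simp add: coeff_w)
    show "2 * k \<le> degree w" by (rule le_degree) (simp add: coeff_w)
  qed
  have "pCons 0 (monom b i) = monom b (Suc i)" for b :: 'a and i by (simp add: monom_Suc)
  then have "[:0, 1:] * w = (\<Sum>j = 1..k. monom (a j) (Suc (2 * k - j))) + monom 1 (Suc (2 * k))"
    by (simp add: w_def distrib_left sum_distrib_left)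
  moreover have "(\<Sum>j = 1..k. monom (a j) (Suc (2 * k - j))) = (\<Sum>j = 1..k. monom (a j) (n - j))"
    by (intro sum.cong) (auto simp: n Suc_diff_le)
  moreover have "pCons c w = [:0, 1:] * w + [:c:]" by simp
  ultimately have gw: "g = pCons c w"
    unfolding g by (simp only: flip: k_def) (simp add: n add_ac)
  have deg_g: "degree g = n" using deg_w k by (simp add: gw n degree_pCons_eq_if) auto
  have "lead_coeff g = 1" by (simp add: deg_g) (simp add: gw n coeff_w)
  moreover have roots: "poly g (\<alpha> $ i) = 0" for i
    using \<open>range (\<lambda>i. \<alpha> $ i) = {x. poly g x = 0}\<close> by auto
  ultimately have prod: "g = (\<Prod>i\<in>UNIV. [:- \<alpha> $ i, 1:])"
    using inj deg_g \<open>CARD('n) = n\<close> by (intro monic_eq_prod_roots) auto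
  define L where "L f = (\<Sum>i\<in>UNIV. (v $ i) ^ 2 * poly f (\<alpha> $ i))" for f
  have L_low: "L f = coeff f (2 * k)" if "degree f \<le> 2 * k" for f
    using lagrange_coeff_sum[OF inj, of f] that \<open>CARD('n) = n\<close>
    by (simp add: L_def v n flip: prod)
  define B where "B = monom \<rho> k + smult \<eta> w"
  define A where "A f = (\<Sum>i<k. monom (f i) i)" for f :: "nat \<Rightarrow> 'a"
  have coeff_A: "coeff (A f) i = (if i < k then f i else 0)" for f i
    by (simp add: A_def coeff_sum)
  have deg_A: "degree (A f) < k" for f
    using k by (intro degree_lessI) (auto simp: coeff_A)
  define \<Phi> where "\<Phi> f = A f + smult (f 0) B" for f
  \<comment> \<open>Positivity of \<open>k\<close> matters: for \<open>n = 1\<close> truncated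
    subtraction would leave the index 0 on the left.\<close>
  have "{0..(n - 3) div 2} = {..<k}" using k by (auto simp: n)
  then have S2: "S2 = range \<Phi>"
    unfolding \<open>S2 = _\<close> \<Phi>_def A_def B_def w_def
    by (auto simp: n smult_add_right smult_monom add.assoc mult.commute)
  have C2: "C2 = range (\<lambda>f. ev \<alpha> v (\<Phi> f))"
    by (auto simp: \<open>C2 = _\<close> S2)
  have A_add: "A (\<lambda>i. f i + f' i) = A f + A f'" for f f'
    by (simp add: poly_eq_iff coeff_A)
  have A_smult: "A (\<lambda>i. b * f i) = smult b (A f)" for b f
    by (simp add: poly_eq_iff coeff_A)
  have "vec.subspace C2"
  proof (rule vec.subspaceI)
    have "ev \<alpha> v (\<Phi> (\<lambda>_. 0)) = 0" by (simp add: vec_eq_iff ev_def \<Phi>_def A_def)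
    then show "0 \<in> C2" unfolding C2 by (metis rangeI)
  next
    fix x y assume "x \<in> C2" "y \<in> C2"
    then obtain f f' where "x = ev \<alpha> v (\<Phi> f)" "y = ev \<alpha> v (\<Phi> f')" by (auto simp: C2)
    then have "x + y = ev \<alpha> v (\<Phi> (\<lambda>i. f i + f' i))"
      by (simp add: vec_eq_iff ev_def \<Phi>_def A_add algebra_simps)
    then show "x + y \<in> C2" by (auto simp: C2)
  next
    fix b x assume "x \<in> C2"
    then obtain f where "x = ev \<alpha> v (\<Phi> f)" by (auto simp: C2)
    then have "b *s x = ev \<alpha> v (\<Phi> (\<lambda>i. b * f i))"
      by (simp add: vec_eq_iff ev_def \<Phi>_def A_smult algebra_simps)
    then show "b *s x \<in> C2" by (auto simp: C2)
  qed
  moreover have "C2 \<subseteq> euclidean_dual C2"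
  proof -
    have "L (\<Phi> f * \<Phi> f') = 0" for f f'
    proof -
      have "L ((A f + smult (coeff (A f) 0) B) * (A f' + smult (coeff (A f') 0) B)) = 0"
        unfolding B_def
      proof (rule twisted_products_vanish[where g = g and c = c])
        show "L (f + h) = L f + L h" for f h
          by (simp add: L_def distrib_left sum.distrib)
        show "L (smult b f) = b * L f" for b f
          by (simp add: L_def sum_distrib_left mult.left_commute)
        show "L (g * f) = 0" for f by (simp add: L_def roots)
      qed (use L_low gw deg_w coeff_w k \<open>\<rho> ^ 2 = - 2 * \<eta>\<close> deg_A in auto)
      then show ?thesis using k by (simp add: \<Phi>_def coeff_A)
    qed
    moreover have "(\<Sum>i\<in>UNIV. ev \<alpha> v f $ i * ev \<alpha> v f' $ i) = L (f * f')" for f f'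
      by (auto simp: L_def ev_def power2_eq_square mult_ac intro: sum.cong)
    ultimately show ?thesis by (auto simp: C2 euclidean_dual_def)
  qed
  moreover have "card C2 = CARD('a) ^ k"
  proof -
    let ?R = "{..<k} \<rightarrow>\<^sub>E (UNIV :: 'a set)"
    \<comment> \<open>Only the first \<open>k\<close> values enter, including \<open>f 0\<close>
      since \<open>k > 0\<close>. Extensional functions therefore give a finite parameter
      set.\<close>
    have "\<Phi> f = \<Phi> (restrict f {..<k})" for f using k by (simp add: \<Phi>_def A_def)
    moreover have "restrict f {..<k} \<in> ?R" for f by (simp add: restrict_PiE_iff)
    ultimately have "range \<Phi> \<subseteq> \<Phi> ` ?R" by blast
    then have "C2 = (\<lambda>f. ev \<alpha> v (\<Phi> f)) ` ?R"
      unfolding C2 by auto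
    moreover have "inj_on (\<lambda>f. ev \<alpha> v (\<Phi> f)) ?R"
    proof (rule inj_onI)
      fix f f' assume R: "f \<in> ?R" "f' \<in> ?R" and eq: "ev \<alpha> v (\<Phi> f) = ev \<alpha> v (\<Phi> f')"
      have deg: "degree (\<Phi> f) < n" for f
      proof -
        have "degree (\<Phi> f) \<le> 2 * k"
          by (rule degree_le) (auto simp: \<Phi>_def coeff_A B_def coeff_w)
        then show ?thesis by (simp add: n)
      qed
      \<comment> \<open>The roots are simple, so no \<open>v $ i\<close> is zero and equal codewords
        give equal values at all \<open>n\<close> nodes.\<close>
      have "poly (pderiv g) (\<alpha> $ i) \<noteq> 0" for i
        using inj by (auto simp: prod poly_pderiv_prod_linear dest: injD)
      then have "v $ i \<noteq> 0" for i using v[of i] by auto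
      then have "poly (\<Phi> f) (\<alpha> $ i) = poly (\<Phi> f') (\<alpha> $ i)" for i
        using eq by (simp add: ev_def vec_eq_iff)
      then have "\<Phi> f = \<Phi> f'"
        by (intro poly_eqI_degree[where A = "range (\<lambda>i. \<alpha> $ i)"])
          (auto simp: card_image[OF inj] \<open>CARD('n) = n\<close> deg)
      \<comment> \<open>\<open>B\<close> has no term below degree \<open>k\<close>, so the
        parameters can be read off the low coefficients.\<close>
      moreover have "coeff (\<Phi> f) i = f i" if "i < k" for f i
        using that by (simp add: \<Phi>_def coeff_A B_def coeff_w)
      ultimately have "f i = f' i" if "i < k" for i using that by metis
      then show "f = f'" using R by (intro PiE_ext) auto
    qed
    ultimately have "card C2 = card ?R" by (simp add: card_image)
    then show ?thesis by (simp add: card_PiE)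
  qed
  ultimately have "stabilizer_code_params (css_space C2) CARD('n) 1
      (min_wt (euclidean_dual C2 - C2)) CARD('a)"
    using n \<open>CARD('n) = n\<close> by (intro css_code_params[OF card, where k = k]) auto
  then show ?thesis
    using \<open>CARD('n) = n\<close> \<open>n = r * p ^ s\<close> \<open>CARD('a) = q ^ 2\<close> by auto
qed

end
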